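(* Let $H=H_0+\hbar H_1+\cdots\in\mathbf M_N[[\hbar]]$ be a formal power series of matrix-valued functions on phase space, let $\lambda$ be a regular eigenvalue function for $H$, let $\pi_0$ be the associated projection onto the eigenbundle $E_\lambda$, and let $\pi\in\mathbf M_N[[\hbar]]$ be the projection ($\pi *_\hbar\pi=\pi$) with principal symbol $\pi_0$ which commutes with $H$ with respect to $*_\hbar$. Let $E$ be a number, let $L$ be a lagrangian submanifold of phase space on which $\lambda$ has the constant value $E$, and let $\psi$ be a WKB wave function associated with $L$, with principal symbol $u$, such that $\pi\psi=\psi$ (so that $u$ is a half-density on $L$ with values in the $\lambda$-eigenbundle). Then $(H-EI)\psi$ is of order $\hbar$, and the principal symbol of $\hbar^{-1}(H-EI)\psi$ vanishes if and only if $u$ satisfies the transport equation $$\pi_0\,\mathcal L_{X_\lambda}u+\Bigl(-\tfrac12\,\pi_0\{\pi_0,H_0-\lambda I\}\pi_0+i\,\pi_0H_1\pi_0\Bigr)u=0 .$$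
   Context: Phase space is $\mathbb R^{2n}$ with its standard symplectic structure and Poisson bracket $\{\cdot,\cdot\}$. $\mathbf A$ is the algebra of smooth complex-valued functions on phase space, $\mathbf M_N$ the algebra of $N\times N$ matrices over $\mathbf A$ with pointwise multiplication, and $\mathbf M_N[[\hbar]]$ the formal power series in $\hbar$ with coefficients in $\mathbf M_N$, multiplied as matrices with entries in $\mathbf A[[\hbar]]$, where $\mathbf A[[\hbar]]$ carries the Moyal product $a *_\hbar b=ab+\frac{i\hbar}{2}\{a,b\}+O(\hbar^2)$. The Poisson bracket of matrix-valued functions is $\{a,b\}_{ij}=\sum_k\{a_{ik},b_{kj}\}$. The principal symbol of $A=A_0+\hbar A_1+\cdots$ is $A_0$. A smooth scalar function $\lambda$ is a regular eigenvalue function for $H$ if $\lambda(x)$ is an eigenvalue of $H_0(x)$ with multiplicity independent of $x$, and for every $x$ the null space and the range of $H_0(x)-\lambda(x)I$ are complementary subspaces. $\pi_0(x)$ is the projection onto the null space of $H_0(x)-\lambda(x)I$ along its range; it is smooth in $x$. $E_\lambda$ (the $\lambda$-eigenbundle) is the bundle of images of $\pi_0(x)$. A (unique) projection $\pi$ as in the claim exists. WKB calculus. For a lagrangian submanifold $L$, the Maslov procedure yields a space $W_L$ of $\hbar$-dependent wave functions associated with $L$, which is a left module over $\mathbf M_N[[\hbar]]$ (acting by Weyl quantization, with $(A *_\hbar B)\psi=A(B\psi)$), on which multiplication by $\hbar$ is injective, and a linear principal symbol map from $W_L$ to half-densities on $L$ with values in $\mathbb C^N$, whose kernel is $\hbar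 W_L$ (elements of $\hbar^kW_L$ are "of order $\hbar^k$"). For example, if $L=\{p=dS(q)\}$, the elements are $e^{iS(q)/\hbar}a(q)\sqrt{|dq|}$ with $a=a_0+\hbar a_1+\cdots$ a formal series of $\mathbb C^N$-valued smooth functions, with principal symbol $a_0(q)\sqrt{|dq|}$ ($q$ being used as a coordinate on $L$). The following standard properties hold for $\psi\in W_L$ with principal symbol $u$: (i) $A\psi$ has principal symbol $A_0u$ (with $A_0$ restricted to $L$); (ii) if $A_0=a_0I$ with $a_0$ a scalar function vanishing on $L$, then $A\psi$ is of order $\hbar$ and $\hbar^{-1}A\psi$ has principal symbol $A_1u-i\mathcal L_{X_{a_0}}u$. Here $X_{a}$ is the hamiltonian vector field of $a$, with the convention $X_a f=\{f,a\}$ (it is tangent to $L$ whenever $a$ is constant on $L$), and $\mathcal L$ is the Lie derivative of $\mathbb C^N$-valued half-densities on $L$, $\mathbb C^N$ being treated as a trivial bundle. *)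

theory Defs
  imports
    "HOL-Analysis.Analysis"
    "HOL-Library.Function_Algebras"
    "HOL-Computational_Algebra.Formal_Power_Series"
begin

section \<open>Smooth functions on phase space\<close>

text \<open>
  Phase space is the space of pairs \<open>(q, p)\<close> of vectors in \<open>\<real>\<^sup>n\<close>, with \<open>n = CARD('n)\<close>.
\<close>

type_synonym 'n phase = "(real, 'n) vec \<times> (real, 'n) vec"

type_synonym ('n, 'm) matfun = "'n phase \<Rightarrow> ((complex, 'm) vec, 'm) vec"

text \<open>
  Only meaningful for open sets \<open>S\<close>, since two-sided derivatives are used.
\<close>

primrec ck_on :: "nat \<Rightarrow> 'a::real_normed_vector set \<Rightarrow> ('a \<Rightarrow> 'b::real_normed_vector) \<Rightarrow> bool" where
  "ck_on 0 S f \<longleftrightarrow> continuous_on S f"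
| "ck_on (Suc k) S f \<longleftrightarrow>
     (\<forall>x\<in>S. f differentiable (at x)) \<and> (\<forall>v. ck_on k S (\<lambda>x. frechet_derivative f (at x) v))"

definition smooth_on :: "'a::real_normed_vector set \<Rightarrow> ('a \<Rightarrow> 'b::real_normed_vector) \<Rightarrow> bool" where
  "smooth_on S f \<longleftrightarrow> (\<forall>k. ck_on k S f)"

definition dq :: "'n::finite \<Rightarrow> ('n phase \<Rightarrow> 'b::real_normed_vector) \<Rightarrow> 'n phase \<Rightarrow> 'b" where
  "dq i f x = frechet_derivative f (at x) (axis i 1, 0)"

definition dp :: "'n::finite \<Rightarrow> ('n phase \<Rightarrow> 'b::real_normed_vector) \<Rightarrow> 'n phase \<Rightarrow> 'b" where
  "dp i f x = frechet_derivative f (at x) (0, axis i 1)"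

definition poisson ::
  "('n::finite phase \<Rightarrow> 'b::real_normed_algebra) \<Rightarrow> ('n phase \<Rightarrow> 'b) \<Rightarrow> 'n phase \<Rightarrow> 'b" where
  "poisson f g x = (\<Sum>i\<in>UNIV. dq i f x * dp i g x - dp i f x * dq i g x)"

definition mat_poisson :: "('n::finite, 'm::finite) matfun \<Rightarrow> ('n, 'm) matfun \<Rightarrow> ('n, 'm) matfun" where
  "mat_poisson a b x =
     (\<chi> i j. \<Sum>k\<in>UNIV. poisson (\<lambda>y. a y $ i $ k) (\<lambda>y. b y $ k $ j) x)"

definition hamiltonian_field :: "('n::finite phase \<Rightarrow> real) \<Rightarrow> 'n phase \<Rightarrow> 'n phase" where
  "hamiltonian_field a x = (\<chi> i. dp i a x, \<chi> i. - dq i a x)"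

lemma hamiltonian_field_poisson:
  fixes f a :: "'n::finite phase \<Rightarrow> real"
  assumes "f differentiable (at x)"
  shows "frechet_derivative f (at x) (hamiltonian_field a x) = poisson f a x"
proof -
  let ?D = "frechet_derivative f (at x)"
  have lin: "linear ?D"
    using assms by (rule linear_frechet_derivative)
  have "hamiltonian_field a x =
      (\<Sum>i\<in>UNIV. dp i a x *\<^sub>R (axis i 1, 0)) - (\<Sum>i\<in>UNIV. dq i a x *\<^sub>R (0, axis i 1))"
      (is "_ = ?r")
    by (auto simp: hamiltonian_field_def prod_eq_iff fst_sum snd_sum vec_eq_iff axis_def
        if_distrib cong: if_cong)
  moreover have "?D ?r = poisson f a x"
    unfolding linear_diff[OF lin] linear_sum[OF lin] linear_cmul[OF lin] poisson_def sum_subtractf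
    by (simp add: dq_def[of _ f] dp_def[of _ f] mult.commute)
  ultimately show ?thesis by simp
qed

section \<open>Formal power series and the Moyal product\<close>

text \<open>
  Only the additive structure of the type \<open>fps\<close> is used: its multiplication on series of
  matrix-valued functions would be the entrywise one.
\<close>

primrec moyal_term ::
  "nat \<Rightarrow> ('n::finite phase \<Rightarrow> complex) \<Rightarrow> ('n phase \<Rightarrow> complex) \<Rightarrow> 'n phase \<Rightarrow> complex" where
  "moyal_term 0 f g = (\<lambda>x. f x * g x)"
| "moyal_term (Suc k) f g =
     (\<lambda>x. \<Sum>i\<in>UNIV. moyal_term k (dq i f) (dp i g) x - moyal_term k (dp i f) (dq i g) x)"

text \<open>
  The Moyal product of two functions is the series with coefficients
  \<open>(\<i>/2)\<^sup>k / k! \<cdot> moyal_term k f g\<close>; it is extended bilinearly over the powers of \<open>\<hbar>\<close>.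
\<close>

definition moyal ::
  "('n::finite phase \<Rightarrow> complex) fps \<Rightarrow> ('n phase \<Rightarrow> complex) fps \<Rightarrow> ('n phase \<Rightarrow> complex) fps" where
  "moyal a b = Abs_fps (\<lambda>r x. \<Sum>k\<le>r. \<Sum>l\<le>r - k.
     (\<i> / 2) ^ k / fact k * moyal_term k (fps_nth a l) (fps_nth b (r - k - l)) x)"

definition mat_entry ::
  "('n, 'm::finite) matfun fps \<Rightarrow> 'm \<Rightarrow> 'm \<Rightarrow> ('n phase \<Rightarrow> complex) fps" where
  "mat_entry A i j = Abs_fps (\<lambda>r x. fps_nth A r x $ i $ j)"

definition mat_moyal ::
  "('n::finite, 'm::finite) matfun fps \<Rightarrow> ('n, 'm) matfun fps \<Rightarrow> ('n, 'm) matfun fps" where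
  "mat_moyal A B = Abs_fps (\<lambda>r x. \<chi> i j.
     \<Sum>k\<in>UNIV. fps_nth (moyal (mat_entry A i k) (mat_entry B k j)) r x)"

lemma moyal_nth_0: "fps_nth (moyal a b) 0 x = fps_nth a 0 x * fps_nth b 0 x"
  by (simp add: moyal_def)

lemma moyal_nth_1:
  "fps_nth (moyal a b) 1 x =
     fps_nth a 0 x * fps_nth b 1 x + fps_nth a 1 x * fps_nth b 0 x
     + \<i> / 2 * poisson (fps_nth a 0) (fps_nth b 0) x"
  by (simp add: moyal_def poisson_def)

definition smooth_fps :: "('n::finite, 'm::finite) matfun fps set" where
  "smooth_fps = {A. \<forall>k. smooth_on UNIV (fps_nth A k)}"

definition const_fps :: "complex \<Rightarrow> ('n::finite, 'm::finite) matfun fps" where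
  "const_fps c = fps_const (\<lambda>x. mat c)"

definition hbar :: "('n::finite, 'm::finite) matfun fps" where
  "hbar = Abs_fps (\<lambda>k x. if k = 1 then mat 1 else mat 0)"

section \<open>Eigenvalue functions\<close>

definition null_space :: "complex^'m^'m \<Rightarrow> (complex^'m) set" where
  "null_space M = {v. M *v v = 0}"

definition complementary :: "'a::ab_group_add set \<Rightarrow> 'a set \<Rightarrow> bool" where
  "complementary K R \<longleftrightarrow> K \<inter> R = {0} \<and> (\<forall>v. \<exists>k\<in>K. \<exists>r\<in>R. v = k + r)"

definition regular_eigenvalue ::
  "('n::finite, 'm::finite) matfun fps \<Rightarrow> ('n phase \<Rightarrow> complex) \<Rightarrow> bool" where
  "regular_eigenvalue H lam \<longleftrightarrow>
     smooth_on UNIV lam \<and>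
     (\<forall>x. \<exists>v. v \<noteq> 0 \<and> fps_nth H 0 x *v v = lam x *s v) \<and>
     (\<exists>d. \<forall>x. vec.dim (null_space (fps_nth H 0 x - mat (lam x))) = d) \<and>
     (\<forall>x. complementary (null_space (fps_nth H 0 x - mat (lam x)))
                        (range ((*v) (fps_nth H 0 x - mat (lam x)))))"

definition projection_along :: "complex^'m^'m \<Rightarrow> (complex^'m) set \<Rightarrow> (complex^'m) set \<Rightarrow> bool" where
  "projection_along P K R \<longleftrightarrow> (\<forall>v\<in>K. P *v v = v) \<and> (\<forall>v\<in>R. P *v v = 0)"

definition eigenprojection ::
  "('n::finite, 'm::finite) matfun fps \<Rightarrow> ('n phase \<Rightarrow> complex) \<Rightarrow> ('n, 'm) matfun \<Rightarrow> bool" where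
  "eigenprojection H lam P \<longleftrightarrow>
     (\<forall>x. projection_along (P x) (null_space (fps_nth H 0 x - mat (lam x)))
                           (range ((*v) (fps_nth H 0 x - mat (lam x)))))"

section \<open>Lagrangian submanifolds\<close>

definition local_param ::
  "'n::finite phase set \<Rightarrow> (real^'n) set \<Rightarrow> (real^'n \<Rightarrow> 'n phase) \<Rightarrow> bool" where
  "local_param L U \<phi> \<longleftrightarrow>
     open U \<and> smooth_on U \<phi> \<and> (\<forall>y\<in>U. inj (frechet_derivative \<phi> (at y))) \<and>
     openin (top_of_set L) (\<phi> ` U) \<and> (\<exists>\<psi>. homeomorphism U (\<phi> ` U) \<phi> \<psi>)"

definition tangent_space :: "'n::finite phase set \<Rightarrow> 'n phase \<Rightarrow> 'n phase set" where
  "tangent_space L x =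
     {frechet_derivative \<phi> (at y) v | U \<phi> y v. local_param L U \<phi> \<and> y \<in> U \<and> \<phi> y = x}"

definition symplectic_form :: "'n::finite phase \<Rightarrow> 'n phase \<Rightarrow> real" where
  "symplectic_form v w = fst v \<bullet> snd w - snd v \<bullet> fst w"

definition lagrangian_submanifold :: "'n::finite phase set \<Rightarrow> bool" where
  "lagrangian_submanifold L \<longleftrightarrow>
     (\<forall>x\<in>L. \<exists>U \<phi>. local_param L U \<phi> \<and> x \<in> \<phi> ` U) \<and>
     (\<forall>x\<in>L. \<forall>v\<in>tangent_space L x. \<forall>w\<in>tangent_space L x. symplectic_form v w = 0)"

section \<open>Half-densities and their Lie derivatives\<close>

text \<open>
  A half-density is encoded as a function \<open>u x e\<close> of a point and an \<open>n\<close>-tuple \<open>e\<close> of vectors. It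
  is set to zero unless \<open>x \<in> L\<close> and \<open>e\<close> consists of tangent vectors of \<open>L\<close> at \<open>x\<close>, so that
  equality of half-densities is equality of functions. The transformation law with singular
  \<open>A\<close> makes it vanish on tuples which are not bases.
\<close>

type_synonym ('n, 'm) half_density = "'n phase \<Rightarrow> ('n phase, 'n) vec \<Rightarrow> (complex, 'm) vec"

definition tangent_tuple :: "'n::finite phase set \<Rightarrow> 'n phase \<Rightarrow> 'n phase^'n \<Rightarrow> bool" where
  "tangent_tuple L x e \<longleftrightarrow> x \<in> L \<and> (\<forall>i. e $ i \<in> tangent_space L x)"

definition half_density_on ::
  "'n::finite phase set \<Rightarrow> ('n, 'm::finite) half_density \<Rightarrow> bool" where
  "half_density_on L u \<longleftrightarrow>
     (\<forall>x e. \<not> tangent_tuple L x e \<longrightarrow> u x e = 0) \<and>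
     (\<forall>x e. tangent_tuple L x e \<longrightarrow> (\<forall>A::real^'n^'n.
        u x (\<chi> j. \<Sum>i\<in>UNIV. A $ i $ j *\<^sub>R e $ i) = sqrt \<bar>det A\<bar> *\<^sub>R u x e)) \<and>
     (\<forall>U \<phi>. local_param L U \<phi> \<longrightarrow>
        smooth_on U (\<lambda>y. u (\<phi> y) (\<chi> i. frechet_derivative \<phi> (at y) (axis i 1))))"

definition local_flow ::
  "('v::real_normed_vector \<Rightarrow> 'v) \<Rightarrow> 'v \<Rightarrow> (real \<Rightarrow> 'v \<Rightarrow> 'v) \<Rightarrow> bool" where
  "local_flow X x \<Phi> \<longleftrightarrow> (\<exists>\<epsilon>>0. \<exists>V. open V \<and> x \<in> V \<and>
     smooth_on ({-\<epsilon><..<\<epsilon>} \<times> V) (\<lambda>(t, y). \<Phi> t y) \<and>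
     (\<forall>y\<in>V. \<Phi> 0 y = y \<and>
        (\<forall>t\<in>{-\<epsilon><..<\<epsilon>}. ((\<lambda>s. \<Phi> s y) has_vector_derivative X (\<Phi> t y)) (at t))))"

text \<open>
  The derivative at \<open>t = 0\<close> of the pull-back of \<open>u\<close> by the flow of \<open>X\<close>. The vector field \<open>X\<close> is
  defined on phase space and is meant to be smooth and tangent to \<open>L\<close>, so that its flow locally
  preserves \<open>L\<close>; the germ of the flow, and hence the result, does not depend on the choice.
\<close>

definition real_lie_derivative ::
  "'n::finite phase set \<Rightarrow> ('n phase \<Rightarrow> 'n phase) \<Rightarrow>
     ('n, 'm::finite) half_density \<Rightarrow> ('n, 'm) half_density" where
  "real_lie_derivative L X u = (\<lambda>x e.
     if tangent_tuple L x e then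
       (let \<Phi> = (SOME \<Phi>. local_flow X x \<Phi>) in
          vector_derivative (\<lambda>t. u (\<Phi> t x) (\<chi> i. frechet_derivative (\<Phi> t) (at x) (e $ i))) (at 0))
     else 0)"

text \<open>
  For a complex-valued function \<open>a\<close>, the hamiltonian vector field is complex, and the Lie
  derivative along it is defined by complex linearity. For real \<open>a\<close> the second term vanishes.
\<close>

definition lie_derivative ::
  "'n::finite phase set \<Rightarrow> ('n phase \<Rightarrow> complex) \<Rightarrow>
     ('n, 'm::finite) half_density \<Rightarrow> ('n, 'm) half_density" where
  "lie_derivative L a u = (\<lambda>x e.
     real_lie_derivative L (hamiltonian_field (\<lambda>y. Re (a y))) u x e
     + \<i> *s real_lie_derivative L (hamiltonian_field (\<lambda>y. Im (a y))) u x e)"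

section \<open>WKB calculus\<close>

definition of_order ::
  "(('n::finite, 'm::finite) matfun fps \<Rightarrow> 'w \<Rightarrow> 'w) \<Rightarrow> nat \<Rightarrow> 'w \<Rightarrow> bool" where
  "of_order act k \<psi> \<longleftrightarrow> (\<exists>\<phi>. \<psi> = (act hbar ^^ k) \<phi>)"

definition hbar_inverse ::
  "(('n::finite, 'm::finite) matfun fps \<Rightarrow> 'w \<Rightarrow> 'w) \<Rightarrow> 'w \<Rightarrow> 'w" where
  "hbar_inverse act \<psi> = (THE \<phi>. act hbar \<phi> = \<psi>)"

text \<open>
  The space \<open>W\<^sub>L\<close> of wave functions associated with \<open>L\<close> is the type \<open>'w\<close>. Multiplication by
  \<open>\<hbar>\<close> and by complex numbers is the action of the corresponding multiples of the identity
  matrix. The operators of Weyl quantization are those in \<open>smooth_fps\<close>; \<open>act\<close> is unconstrained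
  elsewhere.
\<close>

locale wkb_calculus =
  fixes L :: "'n::finite phase set"
    and act :: "('n, 'm::finite) matfun fps \<Rightarrow> 'w::ab_group_add \<Rightarrow> 'w"
    and symb :: "'w \<Rightarrow> ('n, 'm) half_density"
  assumes lagrangian: "lagrangian_submanifold L"
    and act_add_right: "A \<in> smooth_fps \<Longrightarrow> act A (\<psi> + \<phi>) = act A \<psi> + act A \<phi>"
    and act_add_left: "A \<in> smooth_fps \<Longrightarrow> B \<in> smooth_fps \<Longrightarrow> act (A + B) \<psi> = act A \<psi> + act B \<psi>"
    and act_moyal: "A \<in> smooth_fps \<Longrightarrow> B \<in> smooth_fps \<Longrightarrow> act (mat_moyal A B) \<psi> = act A (act B \<psi>)"
    and act_one: "act (const_fps 1) \<psi> = \<psi>"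
    and inj_hbar: "inj (act hbar)"
    and symb_half_density: "half_density_on L (symb \<psi>)"
    and symb_add: "symb (\<psi> + \<phi>) = (\<lambda>x e. symb \<psi> x e + symb \<phi> x e)"
    and symb_scale: "symb (act (const_fps c) \<psi>) = (\<lambda>x e. c *s symb \<psi> x e)"
    and symb_kernel: "symb \<psi> = (\<lambda>x e. 0) \<longleftrightarrow> of_order act 1 \<psi>"
    and symb_act: "A \<in> smooth_fps \<Longrightarrow> symb (act A \<psi>) = (\<lambda>x e. fps_nth A 0 x *v symb \<psi> x e)"
    and order_act: "A \<in> smooth_fps \<Longrightarrow> smooth_on UNIV a \<Longrightarrow> fps_nth A 0 = (\<lambda>x. mat (a x)) \<Longrightarrow>
      \<forall>x\<in>L. a x = 0 \<Longrightarrow> of_order act 1 (act A \<psi>)"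
    and symb_act_order: "A \<in> smooth_fps \<Longrightarrow> smooth_on UNIV a \<Longrightarrow> fps_nth A 0 = (\<lambda>x. mat (a x)) \<Longrightarrow>
      \<forall>x\<in>L. a x = 0 \<Longrightarrow>
      symb (hbar_inverse act (act A \<psi>)) =
        (\<lambda>x e. fps_nth A 1 x *v symb \<psi> x e - \<i> *s lie_derivative L a (symb \<psi>) x e)"

end

theory Submission
  imports Defs
begin

text \<open>
  Split \<open>H - E = K + a\<close> with \<open>K = H - \<lambda>\<close> and \<open>a = \<lambda> - E\<close>. The leading term of \<open>\<pi> * K\<close> is
  \<open>\<pi>\<^sub>0 (H\<^sub>0 - \<lambda>) = 0\<close>, so \<open>\<pi> * K = \<hbar> B\<close>, while \<open>a \<psi> = \<hbar> \<phi>\<close> because \<open>a\<close> vanishes on \<open>L\<close>.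
  As \<open>\<pi>\<close> commutes with \<open>H\<close> and fixes \<open>\<psi>\<close>, this gives \<open>(H - E) \<psi> = \<pi> (H - E) \<psi> = \<hbar> \<xi>\<close> with
  \<open>\<xi> = B \<psi> + \<pi> \<phi>\<close>. Now \<open>\<xi>\<close> is again fixed by \<open>\<pi>\<close>, so its symbol is unchanged by \<open>\<pi>\<^sub>0\<close>, and
  this turns it into \<open>-\<i>\<close> times the left hand side of the transport equation.
\<close>

section \<open>Smooth functions\<close>

text \<open>A two-sided derivative depends only on values near the point, so functions equal on an
  open set have the same derivatives there at every order.\<close>

lemma ck_on_cong:
  assumes "open S" "\<And>x. x \<in> S \<Longrightarrow> f x = g x"
  shows "ck_on k S f \<longleftrightarrow> ck_on k S g"
  using assms(2)
proof (induction k arbitrary: f g)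
  case 0
  then show ?case by (simp cong: continuous_on_cong)
next
  case (Suc k)
  have der: "(f has_derivative D) (at x) \<longleftrightarrow> (g has_derivative D) (at x)" if "x \<in> S" for x D
    using has_derivative_transform_within_open[OF _ \<open>open S\<close> that] Suc.prems by metis
  then have "frechet_derivative f (at x) = frechet_derivative g (at x)" if "x \<in> S" for x
    using that by (simp add: frechet_derivative_def)
  then have "ck_on k S (\<lambda>x. frechet_derivative f (at x) v) \<longleftrightarrow>
      ck_on k S (\<lambda>x. frechet_derivative g (at x) v)" for v
    by (intro Suc.IH) simp
  with der show ?case
    by (simp add: differentiable_def)
qed

text \<open>Allows any explicit formula \<open>f'\<close> for the derivative, so that the
  \<open>has_derivative\<close> rules apply; uniqueness of the derivative identifies it with
  \<open>frechet_derivative\<close>.\<close>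

lemma ck_on_SucI:
  assumes "open S" "\<And>x. x \<in> S \<Longrightarrow> (f has_derivative f' x) (at x)" "\<And>v. ck_on k S (\<lambda>x. f' x v)"
  shows "ck_on (Suc k) S f"
proof -
  have "ck_on k S (\<lambda>x. frechet_derivative f (at x) v)" for v
  proof -
    have "ck_on k S (\<lambda>x. frechet_derivative f (at x) v) \<longleftrightarrow> ck_on k S (\<lambda>x. f' x v)"
      using frechet_derivative_at[OF assms(2)] by (intro ck_on_cong assms(1)) metis
    then show ?thesis using assms(3) by simp
  qed
  then show ?thesis
    using assms(2) by (auto simp: differentiable_def)
qed

lemma ck_on_SucD:
  assumes "ck_on (Suc k) S f" "x \<in> S"
  shows "(f has_derivative frechet_derivative f (at x)) (at x)"
  using assms by (simp add: frechet_derivative_works[symmetric])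

lemma ck_on_Suc_imp: "ck_on (Suc k) S f \<Longrightarrow> ck_on k S f"
proof (induction k arbitrary: f)
  case 0
  then show ?case
    by (auto intro!: continuous_at_imp_continuous_on differentiable_imp_continuous_within)
qed simp

section \<open>Closure properties at a fixed order of differentiability\<close>

lemma ck_on_const: "ck_on k S (\<lambda>x. c)"
  by (induction k arbitrary: c) (simp_all add: frechet_derivative_const)

lemma ck_on_add:
  assumes "open S" "ck_on k S f" "ck_on k S g"
  shows "ck_on k S (\<lambda>x. f x + g x)"
  using assms(2,3)
proof (induction k arbitrary: f g)
  case 0
  then show ?case by (simp add: continuous_on_add)
next
  case (Suc k)
  show ?case
    by (rule ck_on_SucI[OF \<open>open S\<close> has_derivative_add[OF ck_on_SucD ck_on_SucD]])
      (use Suc in auto)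
qed

lemma ck_on_bounded_linear:
  assumes "open S" "bounded_linear h" "ck_on k S f"
  shows "ck_on k S (\<lambda>x. h (f x))"
  using assms(3)
proof (induction k arbitrary: f)
  case 0
  then show ?case by (simp add: bounded_linear.continuous_on[OF assms(2)])
next
  case (Suc k)
  show ?case
    by (rule ck_on_SucI[OF \<open>open S\<close> bounded_linear.has_derivative[OF assms(2) ck_on_SucD]])
      (use Suc in auto)
qed

lemma ck_on_mult:
  fixes f g :: "'a::real_normed_vector \<Rightarrow> 'b::real_normed_algebra"
  assumes "open S" "ck_on k S f" "ck_on k S g"
  shows "ck_on k S (\<lambda>x. f x * g x)"
  using assms(2,3)
proof (induction k arbitrary: f g)
  case 0
  then show ?case by (simp add: continuous_on_mult)
next
  case (Suc k)
  \<comment> \<open>In the Leibniz rule one factor of each product stays undifferentiated; it is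
    lowered to class \<open>k\<close> so that the induction hypothesis covers both products.\<close>
  note ck_on_Suc_imp[OF Suc.prems(1)] ck_on_Suc_imp[OF Suc.prems(2)]
  then have derivative: "ck_on k S
      (\<lambda>x. f x * frechet_derivative g (at x) v + frechet_derivative f (at x) v * g x)" for v
    using Suc.prems by (intro ck_on_add Suc.IH \<open>open S\<close>) simp_all
  show ?case
    by (rule ck_on_SucI[OF \<open>open S\<close> has_derivative_mult[OF ck_on_SucD ck_on_SucD] derivative])
      (use Suc.prems in auto)
qed

section \<open>Closure properties of smooth functions\<close>

lemma smooth_on_const: "smooth_on S (\<lambda>x. c)"
  by (simp add: smooth_on_def ck_on_const)

lemma smooth_on_add:
  "open S \<Longrightarrow> smooth_on S f \<Longrightarrow> smooth_on S g \<Longrightarrow> smooth_on S (\<lambda>x. f x + g x)"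
  by (simp add: smooth_on_def ck_on_add)

lemma smooth_on_bounded_linear:
  "open S \<Longrightarrow> bounded_linear h \<Longrightarrow> smooth_on S f \<Longrightarrow> smooth_on S (\<lambda>x. h (f x))"
  by (simp add: smooth_on_def ck_on_bounded_linear)

lemma smooth_on_mult:
  fixes f g :: "'a::real_normed_vector \<Rightarrow> 'b::real_normed_algebra"
  shows "open S \<Longrightarrow> smooth_on S f \<Longrightarrow> smooth_on S g \<Longrightarrow> smooth_on S (\<lambda>x. f x * g x)"
  by (simp add: smooth_on_def ck_on_mult)

lemma smooth_on_diff:
  assumes "open S" "smooth_on S f" "smooth_on S g"
  shows "smooth_on S (\<lambda>x. f x - g x)"
  using smooth_on_add[OF assms(1,2) smooth_on_bounded_linear[OF assms(1) _ assms(3)],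
      of uminus, OF bounded_linear_minus[OF bounded_linear_ident]]
  by simp

lemma smooth_on_sum:
  assumes "open S" "\<And>i. i \<in> I \<Longrightarrow> smooth_on S (f i)"
  shows "smooth_on S (\<lambda>x. \<Sum>i\<in>I. f i x)"
  using assms(2)
  by (induction I rule: infinite_finite_induct) (auto intro: smooth_on_const smooth_on_add assms(1))

lemma smooth_on_nth: "open S \<Longrightarrow> smooth_on S f \<Longrightarrow> smooth_on S (\<lambda>x. f x $ i)"
  by (rule smooth_on_bounded_linear[OF _ bounded_linear_vec_nth])

lemma bounded_linear_axis: "bounded_linear (axis i :: 'b::real_normed_vector \<Rightarrow> 'b^'m::finite)"
proof (rule bounded_linear_intro)
  show "norm (axis i x :: 'b^'m) \<le> norm x * 1" for x
    by (simp add: axis_def norm_vec_def L2_set_def if_distrib[of norm] if_distrib[of "\<lambda>x. x\<^sup>2"]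
        cong: if_cong)
qed (auto simp: vec_eq_iff axis_def)

lemma smooth_on_vec_lambda:
  fixes f :: "'m::finite \<Rightarrow> 'a::real_normed_vector \<Rightarrow> 'b::real_normed_vector"
  assumes "open S" "\<And>i. smooth_on S (f i)"
  shows "smooth_on S (\<lambda>x. \<chi> i. f i x)"
proof -
  \<comment> \<open>A vector is the finite sum of its components placed on the coordinate axes, and
    each placement is bounded linear.\<close>
  have "smooth_on S (\<lambda>x. \<Sum>i\<in>UNIV. axis i (f i x))"
    by (intro smooth_on_sum smooth_on_bounded_linear[OF _ bounded_linear_axis] assms)
  moreover have "(\<Sum>i\<in>UNIV. axis i (f i x)) = (\<chi> i. f i x)" for x
    by (simp add: vec_eq_iff axis_def)
  ultimately show ?thesis by simp
qed

lemma smooth_on_frechet_derivative: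
  "smooth_on S f \<Longrightarrow> smooth_on S (\<lambda>x. frechet_derivative f (at x) v)"
  unfolding smooth_on_def by (metis ck_on.simps(2))

lemma smooth_on_dq: "smooth_on S f \<Longrightarrow> smooth_on S (dq i f)"
  unfolding dq_def[abs_def] by (rule smooth_on_frechet_derivative)

lemma smooth_on_dp: "smooth_on S f \<Longrightarrow> smooth_on S (dp i f)"
  unfolding dp_def[abs_def] by (rule smooth_on_frechet_derivative)

lemma smooth_on_mat:
  assumes "open S" "smooth_on S a"
  shows "smooth_on S (\<lambda>x. mat (a x) :: 'b::real_normed_vector^'m^'m::finite)"
  unfolding mat_def
proof (intro smooth_on_vec_lambda assms(1))
  show "smooth_on S (\<lambda>x. if i = j then a x else 0)" for i j :: 'm
    using assms(2) by (cases "i = j") (auto intro: smooth_on_const)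
qed

section \<open>Scalar matrices\<close>

lemma mat_matrix_mult_nth:
  "((mat c :: 'a::comm_semiring_1^'m^'m::finite) ** M) $ i $ j = c * M $ i $ j"
  by (simp add: matrix_matrix_mult_def mat_def if_distrib[of "\<lambda>c. c * _"] cong: if_cong)

lemma mat_vector_mult: "(mat c :: 'a::comm_semiring_1^'m^'m::finite) *v v = c *s v"
  by (simp add: vec_eq_iff matrix_vector_mult_def mat_def if_distrib[of "\<lambda>c. c * _"] cong: if_cong)

lemma scaleR_matrix_vector_mult:
  "(c *\<^sub>R M) *v v = of_real c *s (M *v v)" for M :: "'a::real_algebra_1^'n^'m"
  by (simp add: vec_eq_iff matrix_vector_mult_def sum_distrib_left)
    (simp add: scaleR_conv_of_real)

section \<open>The Moyal product\<close>

lemma smooth_on_moyal_term: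
  "open S \<Longrightarrow> smooth_on S f \<Longrightarrow> smooth_on S g \<Longrightarrow> smooth_on S (moyal_term k f g)"
proof (induction k arbitrary: f g)
  case 0
  then show ?case by (simp add: smooth_on_mult)
next
  case (Suc k)
  then show ?case
    unfolding moyal_term.simps
    by (intro smooth_on_sum smooth_on_diff Suc.IH) (auto intro: smooth_on_dq smooth_on_dp)
qed

lemma smooth_fps_mat_moyal:
  assumes "A \<in> smooth_fps" "B \<in> smooth_fps"
  shows "mat_moyal A B \<in> smooth_fps"
  unfolding smooth_fps_def mat_moyal_def moyal_def mat_entry_def fps_nth_Abs_fps mem_Collect_eq
  by (intro allI smooth_on_vec_lambda smooth_on_sum smooth_on_mult smooth_on_const
      smooth_on_moyal_term smooth_on_nth open_UNIV)
    (use assms in \<open>simp_all add: smooth_fps_def\<close>)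

lemma smooth_fps_diff:
  assumes "A \<in> smooth_fps" "B \<in> smooth_fps"
  shows "A - B \<in> smooth_fps"
  using assms unfolding smooth_fps_def by (auto simp: fun_diff_def intro: smooth_on_diff)

lemma smooth_fps_fps_const_mat:
  assumes "smooth_on UNIV a"
  shows "fps_const (\<lambda>x. mat (a x)) \<in> (smooth_fps :: ('n::finite, 'm::finite) matfun fps set)"
proof -
  have "smooth_on UNIV (\<lambda>x. mat (a x) :: complex^'m^'m)"
    using assms by (simp add: smooth_on_mat)
  moreover have "smooth_on UNIV (0 :: ('n, 'm) matfun)"
    unfolding zero_fun_def by (rule smooth_on_const)
  ultimately show ?thesis
    by (simp add: smooth_fps_def fps_const_def)
qed

lemma smooth_fps_const_fps: "const_fps c \<in> smooth_fps"
  unfolding const_fps_def by (rule smooth_fps_fps_const_mat[OF smooth_on_const])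

lemma smooth_fps_hbar: "hbar \<in> smooth_fps"
  unfolding smooth_fps_def hbar_def by (auto intro: smooth_on_const)

section \<open>Products with constants and division by \<hbar>\<close>

lemma dq_const: "dq i (\<lambda>x. c) = (\<lambda>x. 0)"
  by (simp add: fun_eq_iff dq_def frechet_derivative_const)

lemma dp_const: "dp i (\<lambda>x. c) = (\<lambda>x. 0)"
  by (simp add: fun_eq_iff dp_def frechet_derivative_const)

lemma moyal_term_zero:
  "moyal_term k (\<lambda>x. 0) g = (\<lambda>x. 0)" "moyal_term k g (\<lambda>x. 0) = (\<lambda>x. 0)"
  by (induction k arbitrary: g) (simp_all add: dq_const dp_const)

text \<open>Each step of the recursion differentiates both arguments, so a constant argument kills
  every term with \<open>k > 0\<close>.\<close>

lemma moyal_term_const: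
  "moyal_term k (\<lambda>x. c) g = (if k = 0 then \<lambda>x. c * g x else (\<lambda>x. 0))"
  "moyal_term k g (\<lambda>x. c) = (if k = 0 then \<lambda>x. g x * c else (\<lambda>x. 0))"
  by (cases k; simp add: dq_const dp_const moyal_term_zero)+

lemma moyal_const_left:
  assumes "\<And>l. fps_nth a l = (\<lambda>x. c l)"
  shows "fps_nth (moyal a b) r x = (\<Sum>l\<le>r. c l * fps_nth b (r - l) x)"
proof -
  \<comment> \<open>Only \<open>k = 0\<close> survives, which leaves the Cauchy product of the two
    series.\<close>
  have "fps_nth (moyal a b) r x =
      (\<Sum>k\<le>r. if k = 0 then \<Sum>l\<le>r. c l * fps_nth b (r - l) x else 0)"
    unfolding moyal_def fps_nth_Abs_fps by (intro sum.cong) (simp_all add: assms moyal_term_const)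
  then show ?thesis by simp
qed

lemma moyal_const_right:
  assumes "\<And>l. fps_nth b l = (\<lambda>x. c l)"
  shows "fps_nth (moyal a b) r x = (\<Sum>l\<le>r. fps_nth a l x * c (r - l))"
proof -
  have "fps_nth (moyal a b) r x =
      (\<Sum>k\<le>r. if k = 0 then \<Sum>l\<le>r. fps_nth a l x * c (r - l) else 0)"
    unfolding moyal_def fps_nth_Abs_fps by (intro sum.cong) (simp_all add: assms moyal_term_const)
  then show ?thesis by simp
qed

lemma mat_moyal_scalar_left:
  assumes C: "\<And>l. fps_nth C l = (\<lambda>x. mat (c l))"
  shows "fps_nth (mat_moyal C A) r x $ i $ j = (\<Sum>l\<le>r. c l * fps_nth A (r - l) x $ i $ j)"
proof -
  have entry: "fps_nth (mat_entry C i k) l = (\<lambda>x. if i = k then c l else 0)" for k l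
    by (simp add: mat_entry_def C mat_def)
  have "fps_nth (mat_moyal C A) r x $ i $ j =
      (\<Sum>k\<in>UNIV. \<Sum>l\<le>r. (if i = k then c l else 0) * fps_nth A (r - l) x $ k $ j)"
    unfolding mat_moyal_def fps_nth_Abs_fps vec_lambda_beta moyal_const_left[OF entry]
    by (simp add: mat_entry_def)
  also have "\<dots> = (\<Sum>k\<in>UNIV. if k = i then \<Sum>l\<le>r. c l * fps_nth A (r - l) x $ i $ j else 0)"
    by (intro sum.cong) auto
  finally show ?thesis by simp
qed

lemma mat_moyal_scalar_right:
  assumes C: "\<And>l. fps_nth C l = (\<lambda>x. mat (c l))"
  shows "fps_nth (mat_moyal A C) r x $ i $ j = (\<Sum>l\<le>r. c l * fps_nth A (r - l) x $ i $ j)"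
proof -
  have entry: "fps_nth (mat_entry C k j) l = (\<lambda>x. if k = j then c l else 0)" for k l
    by (simp add: mat_entry_def C mat_def)
  have "fps_nth (mat_moyal A C) r x $ i $ j =
      (\<Sum>k\<in>UNIV. \<Sum>l\<le>r. fps_nth A l x $ i $ k * (if k = j then c (r - l) else 0))"
    unfolding mat_moyal_def fps_nth_Abs_fps vec_lambda_beta moyal_const_right[OF entry]
    by (simp add: mat_entry_def)
  also have "\<dots> = (\<Sum>k\<in>UNIV. if k = j then \<Sum>l\<le>r. fps_nth A l x $ i $ j * c (r - l) else 0)"
    by (intro sum.cong) auto
  \<comment> \<open>Reflecting \<open>l\<close> to \<open>r - l\<close> brings the sum to the form
    found for the product on the other side.\<close>
  also have "\<dots> = (\<Sum>l\<le>r. c l * fps_nth A (r - l) x $ i $ j)"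
    unfolding atMost_atLeast0 by (subst sum.atLeastAtMost_rev) (simp add: mult.commute)
  finally show ?thesis .
qed

text \<open>Both products reduce to the same sum. This makes \<open>hbar\<close> and
  \<open>const_fps c\<close> central; a nonconstant scalar function would in general leave Poisson
  bracket terms.\<close>

lemma mat_moyal_scalar_commute:
  assumes "\<And>l. fps_nth C l = (\<lambda>x. mat (c l))"
  shows "mat_moyal A C = mat_moyal C A"
  by (simp add: fps_eq_iff fun_eq_iff vec_eq_iff mat_moyal_scalar_left[OF assms]
      mat_moyal_scalar_right[OF assms])

lemma fps_nth_const_fps: "fps_nth (const_fps c) l = (\<lambda>x. mat (if l = 0 then c else 0))"
  by (simp add: const_fps_def zero_fun_def)

lemma fps_nth_hbar: "fps_nth hbar l = (\<lambda>x. mat (if l = 1 then 1 else 0))"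
  by (auto simp: hbar_def)

lemma mat_moyal_hbar_left: "mat_moyal hbar A = Abs_fps (\<lambda>r. if r = 0 then 0 else fps_nth A (r - 1))"
proof -
  have "fps_nth (mat_moyal hbar A) r x $ i $ j = (if r = 0 then 0 else fps_nth A (r - 1) x $ i $ j)"
    for r x i j
  proof -
    have "fps_nth (mat_moyal hbar A) r x $ i $ j =
        (\<Sum>l\<le>r. if l = 1 then fps_nth A (r - 1) x $ i $ j else 0)"
      unfolding mat_moyal_scalar_left[OF fps_nth_hbar] by (intro sum.cong) auto
    then show ?thesis by auto
  qed
  then show ?thesis
    by (auto simp: fps_eq_iff fun_eq_iff vec_eq_iff)
qed

text \<open>Multiplication by \<open>hbar\<close> raises every index by one, so a series without
  leading coefficient can be divided by it.\<close>

lemma mat_moyal_hbar_shift: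
  assumes "fps_nth A 0 = 0"
  shows "mat_moyal hbar (fps_shift 1 A) = A"
  using assms by (auto simp: mat_moyal_hbar_left fps_eq_iff)

section \<open>The two lowest coefficients of a product\<close>

lemma mat_moyal_nth_0: "fps_nth (mat_moyal A B) 0 x = fps_nth A 0 x ** fps_nth B 0 x"
  by (simp add: mat_moyal_def moyal_nth_0 mat_entry_def matrix_matrix_mult_def)

lemma mat_moyal_nth_1:
  "fps_nth (mat_moyal A B) 1 x = fps_nth A 0 x ** fps_nth B 1 x + fps_nth A 1 x ** fps_nth B 0 x
     + mat (\<i> / 2) ** mat_poisson (fps_nth A 0) (fps_nth B 0) x"
  unfolding mat_moyal_def fps_nth_Abs_fps moyal_nth_1
  by (simp add: mat_entry_def mat_matrix_mult_nth vec_eq_iff sum.distrib)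
    (simp add: matrix_matrix_mult_def mat_poisson_def sum_distrib_left sum_distrib_right)

section \<open>The transport equation\<close>

text \<open>The first identity holds because \<open>P x\<close> kills the range. For the second,
  complementarity splits \<open>v\<close> into a null vector and a range vector; \<open>P x\<close>
  keeps the former, which \<open>?K\<close> then kills, and annihilates the latter.\<close>

lemma eigenprojection_mult:
  assumes "regular_eigenvalue H lam" "eigenprojection H lam P"
  shows "P x ** (fps_nth H 0 x - mat (lam x)) = 0" "(fps_nth H 0 x - mat (lam x)) ** P x = 0"
proof -
  let ?K = "fps_nth H 0 x - mat (lam x)"
  have compl: "complementary (null_space ?K) (range ((*v) ?K))"
    and proj: "projection_along (P x) (null_space ?K) (range ((*v) ?K))"
    using assms unfolding regular_eigenvalue_def eigenprojection_def by blast+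
  have "P x *v (?K *v v) = 0" for v
    using proj by (auto simp: projection_along_def)
  then show "P x ** ?K = 0"
    by (simp add: matrix_eq matrix_vector_mul_assoc)
  have "?K *v (P x *v v) = 0" for v
  proof -
    obtain k w where "k \<in> null_space ?K" "v = k + ?K *v w"
      using compl unfolding complementary_def by blast
    then show ?thesis
      using proj by (simp add: projection_along_def matrix_vector_right_distrib null_space_def)
  qed
  then show "?K ** P x = 0"
    by (simp add: matrix_eq matrix_vector_mul_assoc)
qed

text \<open>\<open>frechet_derivative\<close> is chosen by \<open>SOME\<close>, and subtracting a
  constant does not change which linear maps qualify; so the equation holds even where
  \<open>f\<close> is not differentiable.\<close>

lemma frechet_derivative_diff_const:
  "frechet_derivative (\<lambda>x. f x - c) (at x) = frechet_derivative f (at x)"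
proof -
  have "((\<lambda>x. f x - c) has_derivative D) (at x) \<longleftrightarrow> (f has_derivative D) (at x)" for D
    using has_derivative_diff[OF _ has_derivative_const, of "\<lambda>x. f x - c" D "at x" "- c"]
      has_derivative_diff[OF _ has_derivative_const, of f D "at x" c]
    by auto
  then show ?thesis
    by (simp add: frechet_derivative_def)
qed

text \<open>The hamiltonian field sees only derivatives. Hence \<open>lam - E\<close>, to which the
  calculus on \<open>L\<close> applies, has the same Lie derivative as \<open>lam\<close>.\<close>

lemma lie_derivative_diff_const: "lie_derivative L (\<lambda>x. a x - c) u = lie_derivative L a u"
  by (simp add: lie_derivative_def hamiltonian_field_def[abs_def] dq_def dp_def
      frechet_derivative_diff_const)

theorem mainTheorem1:
  fixes H \<pi> :: "('n::finite, 'm::finite) matfun fps"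
    and \<pi>\<^sub>0 :: "('n, 'm) matfun"
    and lam :: "'n phase \<Rightarrow> complex"
    and E :: complex
    and L :: "'n phase set"
    and act :: "('n, 'm) matfun fps \<Rightarrow> 'w::ab_group_add \<Rightarrow> 'w"
    and symb :: "'w \<Rightarrow> ('n, 'm) half_density"
    and \<psi> :: 'w
    and u :: "('n, 'm) half_density"
  assumes "H \<in> smooth_fps"
    and "regular_eigenvalue H lam"
    and "eigenprojection H lam \<pi>\<^sub>0"
    and "\<pi> \<in> smooth_fps"
    and "mat_moyal \<pi> \<pi> = \<pi>"
    and "fps_nth \<pi> 0 = \<pi>\<^sub>0"
    and "mat_moyal \<pi> H = mat_moyal H \<pi>"
    and "lagrangian_submanifold L"
    and "\<forall>x\<in>L. lam x = E"
    and "wkb_calculus L act symb"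
    and "symb \<psi> = u"
    and "act \<pi> \<psi> = \<psi>"
  shows "of_order act 1 (act (H - const_fps E) \<psi>) \<and>
    (symb (hbar_inverse act (act (H - const_fps E) \<psi>)) = (\<lambda>x e. 0) \<longleftrightarrow>
     (\<forall>x\<in>L. \<forall>e. tangent_tuple L x e \<longrightarrow>
        \<pi>\<^sub>0 x *v lie_derivative L lam u x e
        + ((- 1 / 2) *\<^sub>R (\<pi>\<^sub>0 x ** mat_poisson \<pi>\<^sub>0 (\<lambda>y. fps_nth H 0 y - mat (lam y)) x ** \<pi>\<^sub>0 x)
           + mat \<i> ** \<pi>\<^sub>0 x ** fps_nth H 1 x ** \<pi>\<^sub>0 x) *v u x e = 0))"
proof -
  interpret wkb_calculus L act symb
    by fact
  define a where "a = (\<lambda>x. lam x - E)"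
  define K where "K = H - fps_const (\<lambda>x. mat (lam x))"
  define S where "S = (fps_const (\<lambda>x. mat (a x)) :: ('n, 'm) matfun fps)"
  define B where "B = fps_shift 1 (mat_moyal \<pi> K)"
  define \<phi> where "\<phi> = hbar_inverse act (act S \<psi>)"
  define \<xi> where "\<xi> = act B \<psi> + act \<pi> \<phi>"
  have \<pi>0: "fps_nth \<pi> 0 = \<pi>\<^sub>0" and \<pi>\<psi>: "act \<pi> \<psi> = \<psi>" and u: "symb \<psi> = u"
    by fact+

  \<comment> \<open>Smoothness and the splitting of \<open>H - E\<close>\<close>
  have smooth_lam: "smooth_on UNIV lam"
    using \<open>regular_eigenvalue H lam\<close> by (simp add: regular_eigenvalue_def)
  then have smooth_a: "smooth_on UNIV a"
    unfolding a_def by (intro smooth_on_diff smooth_on_const open_UNIV)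
  have K: "K \<in> smooth_fps"
    unfolding K_def
    by (intro smooth_fps_diff smooth_fps_fps_const_mat smooth_lam \<open>H \<in> smooth_fps\<close>)
  have S: "S \<in> smooth_fps"
    unfolding S_def by (intro smooth_fps_fps_const_mat smooth_a)
  have B: "B \<in> smooth_fps"
    using smooth_fps_mat_moyal[OF \<open>\<pi> \<in> smooth_fps\<close> K] by (simp add: B_def smooth_fps_def)
  have HE: "H - const_fps E = K + S"
  proof -
    have "mat (lam x - E) = mat (lam x) - (mat E :: complex^'m^'m)" for x
      by (simp add: mat_def vec_eq_iff)
    then show ?thesis
      by (auto simp: K_def S_def a_def const_fps_def fps_eq_iff fun_eq_iff)
  qed

  \<comment> \<open>Relations between the leading coefficients and \<open>u\<close>\<close>
  have K0: "fps_nth K 0 = (\<lambda>x. fps_nth H 0 x - mat (lam x))" and K1: "fps_nth K 1 = fps_nth H 1"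
    by (simp_all add: K_def fun_eq_iff)
  have \<pi>0_K0: "\<pi>\<^sub>0 x ** fps_nth K 0 x = 0" and K0_\<pi>0: "fps_nth K 0 x ** \<pi>\<^sub>0 x = 0" for x
    using eigenprojection_mult[OF \<open>regular_eigenvalue H lam\<close> \<open>eigenprojection H lam \<pi>\<^sub>0\<close>]
    by (simp_all add: K0)
  have idem: "\<pi>\<^sub>0 x ** \<pi>\<^sub>0 x = \<pi>\<^sub>0 x" for x
    using mat_moyal_nth_0[of \<pi> \<pi> x] by (simp add: \<open>mat_moyal \<pi> \<pi> = \<pi>\<close> \<pi>0)
  \<comment> \<open>Taking symbols in \<open>act \<pi> \<psi> = \<psi>\<close> shows that
    \<open>u\<close> has values in the eigenbundle.\<close>
  have fixed: "\<pi>\<^sub>0 x *v u x e = u x e" for x e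
    using fun_cong[OF fun_cong[OF symb_act[OF \<open>\<pi> \<in> smooth_fps\<close>, of \<psi>]], of x e]
    by (simp add: \<pi>\<psi> u \<pi>0)

  \<comment> \<open>Division by \<hbar> and the scalar part\<close>
  have hbar_comm: "act \<pi> (act hbar \<theta>) = act hbar (act \<pi> \<theta>)" for \<theta>
    unfolding act_moyal[OF \<open>\<pi> \<in> smooth_fps\<close> smooth_fps_hbar, symmetric]
      act_moyal[OF smooth_fps_hbar \<open>\<pi> \<in> smooth_fps\<close>, symmetric]
    by (simp only: mat_moyal_scalar_commute[OF fps_nth_hbar])
  \<comment> \<open>Injectivity of \<open>act hbar\<close> makes the description by
    \<open>THE\<close> unique.\<close>
  have hbar_inverse: "hbar_inverse act (act hbar \<theta>) = \<theta>" for \<theta>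
    unfolding hbar_inverse_def using inj_hbar by (auto simp: inj_eq)
  have "of_order act 1 (act S \<psi>)"
    using \<open>\<forall>x\<in>L. lam x = E\<close> by (intro order_act[OF S smooth_a]) (simp_all add: S_def a_def)
  then have \<phi>: "act S \<psi> = act hbar \<phi>"
    by (auto simp: of_order_def \<phi>_def hbar_inverse)
  have "symb \<phi> = (\<lambda>x e. fps_nth S 1 x *v u x e - \<i> *s lie_derivative L a u x e)"
    unfolding \<phi>_def u[symmetric] using \<open>\<forall>x\<in>L. lam x = E\<close>
    by (intro symb_act_order[OF S smooth_a]) (simp_all add: S_def a_def)
  \<comment> \<open>\<open>S\<close> has no coefficient of order 1, so only the Lie derivative
    remains, and the constant \<open>E\<close> drops out of it.\<close>
  then have symb_\<phi>: "symb \<phi> = (\<lambda>x e. - (\<i> *s lie_derivative L lam u x e))"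
    by (simp add: S_def a_def lie_derivative_diff_const zero_fun_def)

  \<comment> \<open>Divisibility of \<open>(H - E) \<psi>\<close> by \<hbar>\<close>
  have HE_smooth: "H - const_fps E \<in> smooth_fps"
    by (intro smooth_fps_diff smooth_fps_const_fps \<open>H \<in> smooth_fps\<close>)
  have HE_comm: "act \<pi> (act (H - const_fps E) \<psi>) = act (H - const_fps E) \<psi>"
  proof -
    \<comment> \<open>Additivity is given for sums, so \<open>H\<close> is written as
      \<open>(H - E) + E\<close>; cancelling the central part \<open>E\<close> below isolates
      \<open>H - E\<close>.\<close>
    have split: "act H \<theta> = act (H - const_fps E) \<theta> + act (const_fps E) \<theta>" for \<theta>
      using act_add_left[OF HE_smooth smooth_fps_const_fps, of E \<theta>] by simp
    have "act \<pi> (act H \<psi>) = act H \<psi>"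
      using act_moyal[OF \<open>\<pi> \<in> smooth_fps\<close> \<open>H \<in> smooth_fps\<close>, of \<psi>]
        act_moyal[OF \<open>H \<in> smooth_fps\<close> \<open>\<pi> \<in> smooth_fps\<close>, of \<psi>]
      by (simp add: \<open>mat_moyal \<pi> H = mat_moyal H \<pi>\<close> \<pi>\<psi>)
    moreover have "act \<pi> (act (const_fps E) \<psi>) = act (const_fps E) \<psi>"
      using act_moyal[OF \<open>\<pi> \<in> smooth_fps\<close> smooth_fps_const_fps, of E \<psi>]
        act_moyal[OF smooth_fps_const_fps \<open>\<pi> \<in> smooth_fps\<close>, of E \<psi>]
      by (simp add: mat_moyal_scalar_commute[OF fps_nth_const_fps] \<pi>\<psi>)
    ultimately show ?thesis
      by (simp add: split act_add_right[OF \<open>\<pi> \<in> smooth_fps\<close>])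
  qed
  have "fps_nth (mat_moyal \<pi> K) 0 = 0"
    by (simp add: fun_eq_iff mat_moyal_nth_0 \<pi>0 \<pi>0_K0)
  then have "act \<pi> (act K \<psi>) = act hbar (act B \<psi>)"
    unfolding act_moyal[OF \<open>\<pi> \<in> smooth_fps\<close> K, symmetric] act_moyal[OF smooth_fps_hbar B, symmetric]
    by (simp only: B_def mat_moyal_hbar_shift)
  then have HE_\<xi>: "act (H - const_fps E) \<psi> = act hbar \<xi>"
    using HE_comm
    by (simp add: HE act_add_left[OF K S] act_add_right[OF \<open>\<pi> \<in> smooth_fps\<close>] \<phi> hbar_comm
        act_add_right[OF smooth_fps_hbar] \<xi>_def)
  \<comment> \<open>\<pi> commutes with \<open>hbar\<close>, which can then be cancelled from
    \<open>HE_comm\<close>.\<close>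
  then have \<pi>\<xi>: "act \<pi> \<xi> = \<xi>"
    using HE_comm inj_hbar by (simp add: hbar_comm inj_eq)
  have symb_fixed: "symb \<xi> x e = \<pi>\<^sub>0 x *v symb \<xi> x e" for x e
    using fun_cong[OF fun_cong[OF symb_act[OF \<open>\<pi> \<in> smooth_fps\<close>, of \<xi>]], of x e]
    unfolding \<pi>\<xi> \<pi>0 .

  let ?P = "mat_poisson \<pi>\<^sub>0 (\<lambda>y. fps_nth H 0 y - mat (lam y))"
  have symb_B: "symb (act B \<psi>) x e =
      \<pi>\<^sub>0 x *v (fps_nth H 1 x *v u x e) + (\<i> / 2) *s (?P x *v u x e)" for x e
  proof -
    \<comment> \<open>\<open>B\<close> is \<open>mat_moyal \<pi> K\<close> shifted by one, so its
      principal symbol is the first-order coefficient, where the Poisson bracket enters.\<close>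
    have "fps_nth B 0 x = \<pi>\<^sub>0 x ** fps_nth H 1 x + fps_nth \<pi> 1 x ** fps_nth K 0 x + mat (\<i> / 2) ** ?P x"
      using mat_moyal_nth_1[of \<pi> K x] by (simp only: B_def fps_shift_nth add_0 \<pi>0 K0 K1)
    \<comment> \<open>This removes the undetermined coefficient \<open>fps_nth \<pi> 1\<close>:
      \<open>u\<close> is fixed by \<open>\<pi>\<^sub>0\<close>, and \<open>fps_nth K 0\<close>
      kills the image of \<open>\<pi>\<^sub>0\<close>.\<close>
    moreover have "fps_nth K 0 x *v u x e = 0"
      using fixed[of x e] K0_\<pi>0[of x] by (metis matrix_vector_mul_assoc matrix_vector_mult_0)
    ultimately show ?thesis
      by (simp add: symb_act[OF B] u matrix_vector_mult_add_rdistrib mat_vector_mult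
          flip: matrix_vector_mul_assoc)
  qed

  define T where "T x e = \<pi>\<^sub>0 x *v lie_derivative L lam u x e
    + ((- 1 / 2) *\<^sub>R (\<pi>\<^sub>0 x ** ?P x ** \<pi>\<^sub>0 x) + mat \<i> ** \<pi>\<^sub>0 x ** fps_nth H 1 x ** \<pi>\<^sub>0 x) *v u x e"
    for x e
  \<comment> \<open>The factor is that of the Lie derivative in \<open>symb_\<phi>\<close>; it turns
    the coefficients \<open>- 1 / 2\<close> and \<i> of \<open>T\<close> into
    \<open>\<i> / 2\<close> and \<open>1\<close>.\<close>
  have symb_\<xi>: "symb \<xi> x e = (- \<i>) *s T x e" for x e
  proof -
    have "symb \<xi> x e = \<pi>\<^sub>0 x *v (fps_nth H 1 x *v u x e) + (\<i> / 2) *s (\<pi>\<^sub>0 x *v (?P x *v u x e))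
        - \<i> *s (\<pi>\<^sub>0 x *v lie_derivative L lam u x e)"
      \<comment> \<open>The right side of \<open>symb_fixed\<close> contains its left side, so it is
        substituted once. This puts \<open>\<pi>\<^sub>0\<close> in front of every term, and
        \<open>idem\<close> merges it with a \<open>\<pi>\<^sub>0\<close> already there.\<close>
      by (subst symb_fixed)
        (simp add: \<xi>_def symb_add symb_B symb_act[OF \<open>\<pi> \<in> smooth_fps\<close>] symb_\<phi> \<pi>0
          matrix_vector_right_distrib matrix_vector_mul_assoc matrix_mul_assoc idem
          matrix_vector_mult_diff_distrib vector_scalar_commute
          linear_neg[OF matrix_vector_mul_linear])
    \<comment> \<open>The rightmost \<open>\<pi>\<^sub>0\<close> in both matrix terms is absorbed by
      \<open>u\<close>.\<close>
    moreover have "T x e = \<pi>\<^sub>0 x *v lie_derivative L lam u x e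
        - (1 / 2) *s (\<pi>\<^sub>0 x *v (?P x *v u x e)) + \<i> *s (\<pi>\<^sub>0 x *v (fps_nth H 1 x *v u x e))"
      by (simp add: T_def matrix_vector_mult_diff_rdistrib scaleR_matrix_vector_mult fixed
          mat_vector_mult flip: matrix_vector_mul_assoc)
    ultimately show ?thesis
      by (simp only:) (simp add: vec_eq_iff algebra_simps)
  qed
  have "symb \<xi> = (\<lambda>x e. 0) \<longleftrightarrow> (\<forall>x\<in>L. \<forall>e. tangent_tuple L x e \<longrightarrow> T x e = 0)"
  proof -
    \<comment> \<open>Half-densities are zero by convention on other tuples, and
      \<open>- \<i>\<close> is nonzero, so the transport equation on tangent tuples already decides
      whether the whole symbol vanishes.\<close>
    have "T x e = 0" if "\<not> tangent_tuple L x e" for x e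
    proof -
      have "symb \<xi> x e = 0"
        using symb_half_density[of \<xi>] that unfolding half_density_on_def by blast
      then show ?thesis by (simp add: symb_\<xi>)
    qed
    moreover have "symb \<xi> = (\<lambda>x e. 0) \<longleftrightarrow> (\<forall>x e. T x e = 0)"
      unfolding fun_eq_iff symb_\<xi> by simp
    ultimately show ?thesis
      unfolding tangent_tuple_def by blast
  qed
  moreover have "of_order act 1 (act hbar \<xi>)"
    by (auto simp: of_order_def)
  ultimately show ?thesis
    by (simp add: HE_\<xi> hbar_inverse T_def)
qed

end
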